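(* Let $d\ge 1$ be an integer, $D>0$, $\rho_D^2>1$ and $C_D$ a constant. Let $f$ be a function that is analytic in $[0,D^2]$ and analytically continuable to the transformed Bernstein ellipse for $[0,D^2]$ with parameter $\rho_D^2$, with $|f|\le C_D$ inside this ellipse. Define $\mathcal{K}(\mathbf{x},\mathbf{y})=f(\|\mathbf{x}-\mathbf{y}\|_2^2)$ for $\mathbf{x},\mathbf{y}\in[0,D/\sqrt d]^d$. Then for every integer $n\ge 0$, with $$R=R(n,d)=\binom{n+d+2}{d+2},$$ there exist real $d$-variable polynomials $g_1,\dots,g_R$ and $h_1,\dots,h_R$ such that for all $\mathbf{x},\mathbf{y}\in[0,D/\sqrt d]^d$, $$\Big|\mathcal{K}(\mathbf{x},\mathbf{y})-\sum_{i=1}^{R}g_i(\mathbf{x})h_i(\mathbf{y})\Big|\le\frac{2C_D\,\rho_D^{-2n}}{\rho_D^2-1}.$$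
   Context: The function $f$ is real-valued on $[0,D^2]$. For $\rho^2>1$, the Bernstein ellipse on $[-1,1]$ with parameter $\rho^2$ is the open region $E_{\rho^2}\subset\mathbb{C}$ bounded by the ellipse $\{\tfrac12(\rho^2e^{\imath\theta}+\rho^{-2}e^{-\imath\theta}) : \theta\in[0,2\pi)\}$. For an interval $[a,b]$, let $\phi$ be the linear (affine) map taking $[a,b]$ onto $[-1,1]$; the transformed Bernstein ellipse for $[a,b]$ with parameter $\rho^2$ is $\phi^{-1}(E_{\rho^2})$. *)

theory Defs
  imports "HOL-Analysis.Analysis"
begin

(* The power series at x need only represent f at the points of S; at an endpoint of an
   interval S this is one-sided, so nothing is required of f outside S. *)
definition real_analytic_on :: "(real \<Rightarrow> real) \<Rightarrow> real set \<Rightarrow> bool" where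
  "real_analytic_on f S \<longleftrightarrow>
     (\<forall>x\<in>S. \<exists>e>0. \<exists>c :: nat \<Rightarrow> real. \<forall>y\<in>S. \<bar>y - x\<bar> < e \<longrightarrow> (\<lambda>k. c k * (y - x) ^ k) sums f y)"

(* Intended for r > 1; then inside gives the open region enclosed by the curve. *)
definition bernstein_ellipse :: "real \<Rightarrow> complex set" where
  "bernstein_ellipse r =
     inside ((\<lambda>\<theta>. (of_real r * exp (\<i> * of_real \<theta>) + of_real (inverse r) * exp (- \<i> * of_real \<theta>)) / 2)
             ` {0..<2 * pi})"

(* The increasing affine map of [a,b] onto [-1,1], extended to the complex plane.  The
   decreasing one is its negative and yields the same transformed ellipse. *)
definition interval_map :: "real \<Rightarrow> real \<Rightarrow> complex \<Rightarrow> complex" where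
  "interval_map a b z = (2 * z - of_real (a + b)) / of_real (b - a)"

definition transformed_bernstein_ellipse :: "real \<Rightarrow> real \<Rightarrow> real \<Rightarrow> complex set" where
  "transformed_bernstein_ellipse a b r = interval_map a b -` bernstein_ellipse r"

end

theory Submission
  imports Defs "HOL-Complex_Analysis.Complex_Analysis"
begin

text \<open>The Joukowski map \<open>w \<mapsto> (w + 1/w) / 2\<close> sends the annulus \<open>1/r < |w| < r\<close> into the Bernstein
  ellipse with parameter \<open>r = \<rho>\<^sup>2\<close>.  Cauchy's integral formula on this annulus, with the kernel
  \<open>1 / (w - z)\<close> expanded geometrically up to order \<open>n\<close>, leaves on each of the two boundary circles a
  remainder of at most \<open>C r\<^sup>-\<^sup>n / (r - 1)\<close>.  Averaging over \<open>z = e\<^sup>i\<^sup>t\<close> and its inverse turns the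
  truncated Laurent sum into a polynomial of degree at most \<open>n\<close> in \<open>cos t\<close>.
  Finally \<open>|x - y|\<^sup>2 = |x|\<^sup>2 + |y|\<^sup>2 - 2 \<Sum>\<^sub>j x\<^sub>j y\<^sub>j\<close> is a sum of \<open>d + 2\<close> products of a polynomial
  in \<open>x\<close> with one in \<open>y\<close>, so a polynomial of degree \<open>n\<close> in it has as many separable terms as there
  are monomials of degree at most \<open>n\<close> in \<open>d + 2\<close> variables.\<close>

subsection \<open>Separable rank\<close>

text \<open>Zero factors are allowed, so \<open>R\<close> is an upper bound rather than an exact
  rank. The identity is asked for on the whole space, which suits polynomials.\<close>

definition separable_rank_le ::
    "nat \<Rightarrow> ('a::real_normed_vector \<Rightarrow> 'a \<Rightarrow> real) \<Rightarrow> bool" where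
  "separable_rank_le R p \<longleftrightarrow>
     (\<exists>g h. (\<forall>i<R. real_polynomial_function (g i) \<and> real_polynomial_function (h i)) \<and>
            (\<forall>x y. p x y = (\<Sum>i<R. g i x * h i y)))"

lemma sum_lessThan_add_split:
  fixes f :: "nat \<Rightarrow> 'a::comm_monoid_add"
  shows "sum f {..<m + n} = sum f {..<m} + (\<Sum>i<n. f (m + i))"
  by (induction n) (simp_all add: ac_simps)

lemma separable_rank_le_add:
  assumes "separable_rank_le R p" "separable_rank_le S q"
  shows "separable_rank_le (R + S) (\<lambda>x y. p x y + q x y)"
proof -
  obtain g h where gh: "\<And>i. i < R \<Longrightarrow> real_polynomial_function (g i) \<and> real_polynomial_function (h i)"
      "\<And>x y. p x y = (\<Sum>i<R. g i x * h i y)"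
    using assms(1) unfolding separable_rank_le_def by auto
  obtain g' h' where gh': "\<And>i. i < S \<Longrightarrow> real_polynomial_function (g' i) \<and> real_polynomial_function (h' i)"
      "\<And>x y. q x y = (\<Sum>i<S. g' i x * h' i y)"
    using assms(2) unfolding separable_rank_le_def by auto
  show ?thesis
    unfolding separable_rank_le_def
    by (rule exI[of _ "\<lambda>i. if i < R then g i else g' (i - R)"],
        rule exI[of _ "\<lambda>i. if i < R then h i else h' (i - R)"])
       (auto simp: sum_lessThan_add_split gh gh')
qed

lemma separable_rank_le_sum:
  assumes "finite J" "\<And>j. j \<in> J \<Longrightarrow> separable_rank_le (R j) (p j)"
  shows "separable_rank_le (\<Sum>j\<in>J. R j) (\<lambda>x y. \<Sum>j\<in>J. p j x y)"
  using assms
proof (induction J)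
  case empty
  then show ?case by (simp add: separable_rank_le_def)
next
  case (insert j J)
  then show ?case by (simp add: separable_rank_le_add)
qed

lemma separable_rank_le_mult:
  assumes "separable_rank_le R p" "real_polynomial_function u" "real_polynomial_function v"
  shows "separable_rank_le R (\<lambda>x y. (u x * v y) * p x y)"
proof -
  obtain g h where gh: "\<And>i. i < R \<Longrightarrow> real_polynomial_function (g i) \<and> real_polynomial_function (h i)"
      "\<And>x y. p x y = (\<Sum>i<R. g i x * h i y)"
    using assms(1) unfolding separable_rank_le_def by auto
  show ?thesis
    unfolding separable_rank_le_def
    by (rule exI[of _ "\<lambda>i x. u x * g i x"], rule exI[of _ "\<lambda>i y. v y * h i y"])
       (auto simp: gh sum_distrib_left mult_ac intro!: assms real_polynomial_function.intros(4))
qed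

lemma separable_rank_le_power_mult:
  assumes "separable_rank_le R p" "real_polynomial_function u" "real_polynomial_function v"
  shows "separable_rank_le R (\<lambda>x y. (u x * v y) ^ j * p x y)"
  using separable_rank_le_mult[OF assms(1) real_polynomial_function_power[OF assms(2)]
      real_polynomial_function_power[OF assms(3)], of j j]
  by (simp add: power_mult_distrib)

section \<open>Counting the separable terms of a polynomial in a separable sum\<close>

text \<open>Binomial theorem for each power, then summation over the triangle
  \<open>i + j \<le> n\<close>. The cofactor of \<open>b ^ j\<close> is again a polynomial in
  \<open>a\<close>, of degree at most \<open>n - j\<close> and with new coefficients; this is the
  form on which an induction over the number of summands can run.\<close>

lemma sum_power_add_expand:
  fixes a b :: "'a::comm_ring_1"
  shows "(\<Sum>k\<le>n. c k * (a + b) ^ k) =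
         (\<Sum>j\<le>n. b ^ j * (\<Sum>i\<le>n - j. c (i + j) * of_nat ((i + j) choose j) * a ^ i))"
proof -
  \<comment> \<open>Writing \<open>k\<close> as \<open>j + (k - j)\<close> makes the summand a
    function of \<open>j\<close> and \<open>k - j\<close>, as the triangle reindexing
    requires.\<close>
  have "(\<Sum>k\<le>n. c k * (a + b) ^ k) =
        (\<Sum>k\<le>n. \<Sum>j\<le>k. c (j + (k - j)) * of_nat ((j + (k - j)) choose j) * b ^ j * a ^ (k - j))"
    by (intro sum.cong refl, subst add.commute, subst binomial_ring)
       (auto simp: sum_distrib_left mult_ac intro!: sum.cong)
  also have "\<dots> = (\<Sum>(j,i)\<in>{(j,i). j + i \<le> n}. c (j + i) * of_nat ((j + i) choose j) * b ^ j * a ^ i)"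
    by (rule sum.triangle_reindex_eq[symmetric])
  also have "{(j,i). j + i \<le> n} = Sigma {..n} (\<lambda>j. {..n - j})"
    by auto
  finally show ?thesis
    by (simp add: sum.Sigma[symmetric] sum_distrib_left mult_ac add.commute)
qed

text \<open>Induction on \<open>I\<close>. Splitting off one product and collecting its powers
  leaves, for each \<open>j\<close>, a polynomial of degree at most \<open>n - j\<close> in the
  remaining sum, hence the generalisation over \<open>n\<close> and \<open>c\<close>. Multiplying by
  the \<open>j\<close>-th power of a single product costs no rank, so the ranks just add up, and the
  total counts the monomials of degree at most \<open>n\<close> in \<open>card I\<close>
  variables.\<close>

lemma separable_rank_le_polynomial_sum:
  assumes "finite I"
    and "\<And>i. i \<in> I \<Longrightarrow> real_polynomial_function (u i)"
    and "\<And>i. i \<in> I \<Longrightarrow> real_polynomial_function (v i)"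
  shows "separable_rank_le ((n + card I) choose card I)
           (\<lambda>x y. \<Sum>k\<le>n. c k * (\<Sum>i\<in>I. u i x * v i y) ^ k)"
  using assms
proof (induction I arbitrary: n c)
  case empty
  \<comment> \<open>The empty sum is 0 and \<open>0 ^ 0 = 1\<close>: only the constant term
    survives, of rank 1, which is \<open>n choose 0\<close>.\<close>
  have "(\<Sum>k\<le>n. c k * 0 ^ k) = c 0"
    by (simp add: power_0_left if_distrib cong: if_cong)
  then show ?case
    unfolding separable_rank_le_def
    by (intro exI[of _ "\<lambda>_ _. c 0"] exI[of _ "\<lambda>_ _. 1"])
       (simp add: real_polynomial_function.intros(2))
next
  case (insert a I)
  let ?m = "card I"
  let ?s = "\<lambda>x y. \<Sum>i\<in>I. u i x * v i y"
  have "separable_rank_le (\<Sum>j\<le>n. (n - j + ?m) choose ?m)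
      (\<lambda>x y. \<Sum>j\<le>n. (u a x * v a y) ^ j *
        (\<Sum>i\<le>n - j. c (i + j) * of_nat ((i + j) choose j) * ?s x y ^ i))"
    by (intro separable_rank_le_sum separable_rank_le_power_mult insert.IH)
       (use insert.prems in auto)
  moreover have "(\<Sum>j\<le>n. (n - j + ?m) choose ?m) = (\<Sum>j\<le>n. (?m + j) choose ?m)"
    using sum.nat_diff_reindex[of "\<lambda>j. (j + ?m) choose ?m" "Suc n"]
    by (simp add: lessThan_Suc_atMost add.commute)
  \<comment> \<open>The hockey-stick identity, after the order of summation has been
    reversed.\<close>
  moreover have "\<dots> = (n + card (insert a I)) choose card (insert a I)"
    using insert.hyps choose_rising_sum(1)[of ?m n] by (simp add: add_ac)
  moreover have "(\<Sum>i\<in>insert a I. u i x * v i y) = ?s x y + u a x * v a y" for x y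
    using insert.hyps by (simp add: add.commute)
  ultimately show ?case
    by (simp only: sum_power_add_expand)
qed

section \<open>The squared distance as a sum of \<open>d + 2\<close> separable products\<close>

lemma sum_UNIV_option:
  fixes f :: "'a::finite option \<Rightarrow> 'b::comm_monoid_add"
  shows "sum f UNIV = f None + (\<Sum>j\<in>UNIV. f (Some j))"
  by (simp add: UNIV_option_conv sum.reindex)

text \<open>The type \<open>'d option option\<close> serves as an index set with exactly two more
  elements than \<open>'d\<close>: \<open>None\<close> and \<open>Some None\<close> carry the two
  squared norms, \<open>Some (Some j)\<close> the cross term of coordinate \<open>j\<close>.\<close>

lemma norm_diff_power2_separable:
  fixes x y :: "real ^ 'd"
  shows "(norm (x - y))\<^sup>2 =
    (\<Sum>i\<in>UNIV. (case i of None \<Rightarrow> \<lambda>x. (norm x)\<^sup>2 | Some None \<Rightarrow> \<lambda>_. 1 | Some (Some j) \<Rightarrow> \<lambda>x. - 2 * x $ j) x *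
             (case i of None \<Rightarrow> \<lambda>_. 1 | Some None \<Rightarrow> \<lambda>y. (norm y)\<^sup>2 | Some (Some j) \<Rightarrow> \<lambda>y. y $ j) y)"
proof -
  have "(norm (x - y))\<^sup>2 = (norm x)\<^sup>2 + (norm y)\<^sup>2 - 2 * (x \<bullet> y)"
    by (simp add: power2_norm_eq_inner inner_diff_left inner_diff_right inner_commute)
  also have "2 * (x \<bullet> y) = (\<Sum>j\<in>UNIV. 2 * x $ j * y $ j)"
    by (simp add: inner_vec_def sum_distrib_left mult_ac)
  finally show ?thesis
    by (simp add: sum_UNIV_option sum_negf)
qed

lemma separable_rank_le_polynomial_norm_diff:
  fixes c :: "nat \<Rightarrow> real"
  shows "separable_rank_le ((n + CARD('d) + 2) choose (CARD('d) + 2))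
           (\<lambda>x y :: real ^ 'd. \<Sum>k\<le>n. c k * ((norm (x - y))\<^sup>2) ^ k)"
proof -
  have coord: "real_polynomial_function (\<lambda>x :: real ^ 'd. x $ j)" for j
    by (intro real_polynomial_function.intros bounded_linear_vec_nth)
  have scaled_coord: "real_polynomial_function (\<lambda>x :: real ^ 'd. - (2 * x $ j))" for j
    using real_polynomial_function.intros(4)[OF real_polynomial_function.intros(2)[of "- 2"] coord]
    by simp
  have norm: "real_polynomial_function (\<lambda>x :: real ^ 'd. (norm x)\<^sup>2)"
    unfolding power2_norm_eq_inner inner_vec_def inner_real_def
    by (intro real_polynomial_function_sum real_polynomial_function.intros(4) coord) simp
  have "card (UNIV :: 'd option option set) = CARD('d) + 2"
    by simp
  then show ?thesis
    unfolding norm_diff_power2_separable add.assoc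
    by (subst (1 2) \<open>card _ = _\<close>[symmetric], intro separable_rank_le_polynomial_sum)
       (auto split: option.split simp del: card_UNIV_option
          intro!: norm coord scaled_coord real_polynomial_function.intros(2))
qed

subsection \<open>The Bernstein ellipse\<close>

text \<open>\<open>A\<close> and \<open>B\<close> are the half-axes. The boundary curve is the level
  set \<open>q w = 1\<close> of a quadratic form, and the sublevel set \<open>U\<close> is bounded
  with its frontier on the curve. A component of the complement of the curve that starts in
  \<open>U\<close> is therefore trapped there, which is what \<open>inside\<close> demands.\<close>

lemma mem_bernstein_ellipse:
  fixes z :: complex and r :: real
  defines "A \<equiv> (r + inverse r) / 2" and "B \<equiv> (r - inverse r) / 2"
  assumes r: "r > 1" and z: "(Re z / A)\<^sup>2 + (Im z / B)\<^sup>2 < 1"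
  shows "z \<in> bernstein_ellipse r"
proof -
  have AB: "A > 0" "B > 0"
    using r by (auto simp: A_def B_def field_simps less_1_mult intro: add_pos_pos)
  define curve where "curve = (\<lambda>\<theta>. (of_real r * exp (\<i> * of_real \<theta>) +
      of_real (inverse r) * exp (- \<i> * of_real \<theta>)) / (2::complex)) ` {0..<2 * pi}"
  have point: "(of_real r * exp (\<i> * of_real t) + of_real (inverse r) * exp (- \<i> * of_real t)) / 2
      = Complex (A * cos t) (B * sin t)" for t :: real
    by (simp add: complex_eq_iff Re_exp Im_exp A_def B_def field_simps)
  define q where "q = (\<lambda>w :: complex. (Re w / A)\<^sup>2 + (Im w / B)\<^sup>2)"
  have q_cont: "continuous_on UNIV q"
    unfolding q_def by (intro continuous_intros) (use AB in auto)
  have curve_eq: "curve = {w. q w = 1}"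
  proof (intro equalityI subsetI)
    fix w assume "w \<in> curve"
    then show "w \<in> {w. q w = 1}"
      using AB unfolding curve_def point q_def by auto
  next
    fix w assume w: "w \<in> {w. q w = 1}"
    then obtain t where t: "0 \<le> t" "t < 2 * pi" "Re w / A = cos t" "Im w / B = sin t"
      using sincos_total_2pi[of "Re w / A" "Im w / B"] by (auto simp: q_def)
    then have "w = Complex (A * cos t) (B * sin t)"
      using AB by (simp add: complex_eq_iff field_simps)
    then show "w \<in> curve"
      using t unfolding curve_def point by auto
  qed
  define U where "U = {w. q w < 1}"
  have "open U"
    unfolding U_def by (intro open_Collect_less q_cont continuous_intros)
  moreover have "closure U \<subseteq> {w. q w \<le> 1}"
    unfolding U_def by (intro closure_minimal closed_Collect_le q_cont continuous_intros) auto
  ultimately have frontier: "frontier U \<subseteq> curve"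
    by (auto simp: frontier_def interior_open curve_eq U_def)
  have "z \<in> U" using z by (simp add: U_def q_def)
  \<comment> \<open>A connected set that meets \<open>U\<close> and also leaves it must hit the
    frontier of \<open>U\<close>, hence the curve, which this component avoids.\<close>
  have "connected_component_set (- curve) z \<subseteq> U"
  proof (rule ccontr)
    assume "\<not> ?thesis"
    moreover have "z \<in> connected_component_set (- curve) z"
      using \<open>z \<in> U\<close> by (auto simp: curve_eq U_def)
    ultimately have "connected_component_set (- curve) z \<inter> frontier U \<noteq> {}"
      using \<open>z \<in> U\<close>
      by (intro connected_Int_frontier connected_connected_component) (blast, blast)
    then show False
      using frontier connected_component_subset[of "- curve" z] by blast
  qed
  moreover have "bounded U"
  proof (rule boundedI)
    fix w assume "w \<in> U"
    then have "(Re w / A)\<^sup>2 < 1" "(Im w / B)\<^sup>2 < 1"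
      unfolding U_def q_def
      by (smt (verit, best) mem_Collect_eq zero_le_power2)+
    then have "\<bar>Re w / A\<bar> < 1" "\<bar>Im w / B\<bar> < 1"
      by (simp_all only: abs_square_less_1)
    then have "\<bar>Re w\<bar> < A" "\<bar>Im w\<bar> < B"
      using AB by (auto simp: abs_divide)
    then show "norm w \<le> A + B"
      using cmod_le[of w] by linarith
  qed
  ultimately show ?thesis
    using \<open>z \<in> U\<close> unfolding bernstein_ellipse_def curve_def[symmetric] inside_def
    by (auto simp: curve_eq U_def intro: bounded_subset)
qed

text \<open>A point of modulus \<open>s\<close> lands on the confocal ellipse with half-axes
  \<open>(s + 1/s)/2\<close> and \<open>|s - 1/s|/2\<close> (a segment if \<open>s = 1\<close>).
  Both are smaller than those for \<open>r\<close> as long as \<open>1/r < s < r\<close>.\<close>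

lemma joukowski_mem_bernstein_ellipse:
  fixes w :: complex
  assumes "r > 1" "inverse r < norm w" "norm w < r"
  shows "(w + inverse w) / 2 \<in> bernstein_ellipse r"
proof -
  define s where "s = norm w"
  have s: "s > 0" "s < r" "1 < s * r"
    using assms by (auto simp: s_def field_simps)
  define t where "t = Arg w"
  have w: "w = of_real s * cis t"
    unfolding s_def t_def by (metis rcis_cmod_Arg rcis_def)
  have inv: "inverse w = of_real (inverse s) * cis (- t)"
    by (simp add: w)
  have Re: "Re ((w + inverse w) / 2) = (s + inverse s) / 2 * cos t"
    by (subst inv) (simp add: w field_simps)
  have Im: "Im ((w + inverse w) / 2) = (s - inverse s) / 2 * sin t"
    by (subst inv) (simp add: w field_simps)
  \<comment> \<open>Divided by \<open>s * r\<close>, these products are the differences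
    \<open>(r + 1/r) - (s + 1/s)\<close>, \<open>(r - 1/r) + (s - 1/s)\<close> and
    \<open>(r - 1/r) - (s - 1/s)\<close>.\<close>
  have 1: "(r - s) * (s * r - 1) > 0" "(r + s) * (s * r - 1) > 0" "(r - s) * (s * r + 1) > 0"
    using s assms(1) by (auto intro!: mult_pos_pos add_pos_pos)
  have a: "(s + inverse s) / (r + inverse r) < 1" "0 < (s + inverse s) / (r + inverse r)"
    using s assms(1) 1 by (auto simp: field_simps add_pos_pos)
  have b: "\<bar>(s - inverse s) / (r - inverse r)\<bar> < 1"
  proof -
    have "r - inverse r > 0" using assms(1) by (simp add: less_1_mult field_simps)
    moreover have "s - inverse s < r - inverse r" "- (s - inverse s) < r - inverse r"
      using s assms(1) 1 by (auto simp: field_simps)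
    ultimately show ?thesis by (simp add: abs_less_iff field_simps)
  qed
  have "((s + inverse s) / (r + inverse r))\<^sup>2 * (cos t)\<^sup>2 +
        ((s - inverse s) / (r - inverse r))\<^sup>2 * (sin t)\<^sup>2 < 1"
  proof -
    have ab: "((s + inverse s) / (r + inverse r))\<^sup>2 < 1" "((s - inverse s) / (r - inverse r))\<^sup>2 < 1"
      using a b by (simp_all add: abs_square_less_1 del: abs_divide)
    show ?thesis
    \<comment> \<open>Strictness comes from the sine term unless it vanishes, and then from the
      cosine term.\<close>
    proof (cases "sin t = 0")
      case True
      then have "(cos t)\<^sup>2 = 1" using sin_cos_squared_add[of t] by simp
      then show ?thesis using True ab by simp
    next
      case False
      then have "((s - inverse s) / (r - inverse r))\<^sup>2 * (sin t)\<^sup>2 < 1 * (sin t)\<^sup>2"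
        using ab by (intro mult_strict_right_mono) auto
      moreover have "((s + inverse s) / (r + inverse r))\<^sup>2 * (cos t)\<^sup>2 \<le> 1 * (cos t)\<^sup>2"
        using ab by (intro mult_right_mono) auto
      ultimately show ?thesis using sin_cos_squared_add[of t] by linarith
    qed
  qed
  then show ?thesis
    by (intro mem_bernstein_ellipse assms(1), unfold Re Im) (simp add: power_mult_distrib power_divide)
qed

subsection \<open>Laurent truncation on an annulus\<close>

text \<open>The straight-line homotopy joins points of equal argument, so the moduli in between are
  convex combinations of \<open>s\<close> and \<open>t\<close> and stay in the annulus.\<close>

lemma contour_integral_circlepath_annulus:
  assumes hol: "f holomorphic_on {w. a < norm w \<and> norm w < b}"
    and "0 \<le> a" "a < s" "s < b" "a < t" "t < b"
  shows "contour_integral (circlepath 0 s) f = contour_integral (circlepath 0 t) f"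
proof (rule Cauchy_theorem_homotopic_loops[OF _ _ hol])
  show "open {w :: complex. a < norm w \<and> norm w < b}"
    by (intro open_Collect_conj open_Collect_less continuous_intros)
  show "homotopic_loops {w. a < norm w \<and> norm w < b} (circlepath 0 s) (circlepath 0 t)"
  proof (rule homotopic_loops_linear)
    fix \<theta> :: real
    show "closed_segment (circlepath 0 s \<theta>) (circlepath 0 t \<theta>) \<subseteq> {w. a < norm w \<and> norm w < b}"
    proof
      fix w assume "w \<in> closed_segment (circlepath 0 s \<theta>) (circlepath 0 t \<theta>)"
      then obtain u where u: "0 \<le> u" "u \<le> 1"
        "w = (1 - u) *\<^sub>R circlepath 0 s \<theta> + u *\<^sub>R circlepath 0 t \<theta>"
        by (auto simp: in_segment)
      have "w = of_real ((1 - u) * s + u * t) * exp (2 * of_real pi * \<i> * of_real \<theta>)"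
        by (simp add: u circlepath scaleR_conv_of_real algebra_simps)
      then have "norm w = \<bar>(1 - u) * s + u * t\<bar>"
        by (simp only: norm_mult norm_of_real) simp
      moreover have "a < (1 - u) * s + u * t" "(1 - u) * s + u * t < b"
        using convex_bound_lt[of "-s" "-a" "-t" "1 - u" u] convex_bound_lt[of s b t "1 - u" u]
          u assms by auto
      ultimately show "w \<in> {w. a < norm w \<and> norm w < b}"
        using \<open>0 \<le> a\<close> by auto
    qed
  qed auto
qed auto

text \<open>The difference quotient of \<open>f\<close> at \<open>z\<close> has a removable
  singularity, so its integrals over the two circles agree. What remains is the integral of
  \<open>1 / (w - z)\<close>: it is \<open>2 * pi * \<i>\<close> over the outer circle, which
  encloses \<open>z\<close>, and 0 over the inner one, which does not.\<close>

lemma Cauchy_integral_formula_annulus: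
  assumes hol: "f holomorphic_on {w. a < norm w \<and> norm w < b}"
    and "0 \<le> a" "a < s" "s < norm z" "norm z < t" "t < b"
  shows "contour_integral (circlepath 0 t) (\<lambda>w. f w / (w - z)) -
         contour_integral (circlepath 0 s) (\<lambda>w. f w / (w - z)) = 2 * pi * \<i> * f z"
proof -
  let ?A = "{w. a < norm w \<and> norm w < b}"
  have "open ?A"
    by (intro open_Collect_conj open_Collect_less continuous_intros)
  define \<Phi> where "\<Phi> = (\<lambda>w. if w = z then deriv f z else (f w - f z) / (w - z))"
  have "\<Phi> holomorphic_on ?A"
    unfolding \<Phi>_def by (rule pole_lemma_open[OF hol \<open>open ?A\<close>])
  then have eq: "contour_integral (circlepath 0 t) \<Phi> = contour_integral (circlepath 0 s) \<Phi>"
    by (rule contour_integral_circlepath_annulus) (use assms in auto)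
  have split: "contour_integral (circlepath 0 q) \<Phi> =
      contour_integral (circlepath 0 q) (\<lambda>w. f w / (w - z)) -
      f z * contour_integral (circlepath 0 q) (\<lambda>w. 1 / (w - z))"
    if q: "q \<in> {s, t}" for q
  proof -
    have pos: "q > 0" "q \<noteq> norm z" "a < q" "q < b" using q assms by auto
    have cont: "continuous_on (sphere 0 q) f"
      by (intro holomorphic_on_imp_continuous_on holomorphic_on_subset[OF hol]) (use pos in auto)
    have "contour_integral (circlepath 0 q) \<Phi> =
        contour_integral (circlepath 0 q) (\<lambda>w. f w / (w - z) - f z * (1 / (w - z)))"
      by (intro contour_integral_cong) (use pos in \<open>auto simp: \<Phi>_def diff_divide_distrib\<close>)
    also have "\<dots> = contour_integral (circlepath 0 q) (\<lambda>w. f w / (w - z)) -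
      contour_integral (circlepath 0 q) (\<lambda>w. f z * (1 / (w - z)))"
      by (intro contour_integral_diff contour_integrable_continuous_circlepath continuous_intros)
         (use pos cont in \<open>auto\<close>)
    also have "contour_integral (circlepath 0 q) (\<lambda>w. f z * (1 / (w - z))) =
       f z * contour_integral (circlepath 0 q) (\<lambda>w. 1 / (w - z))"
      by (intro contour_integral_lmul contour_integrable_continuous_circlepath continuous_intros)
         (use pos in \<open>auto\<close>)
    finally show ?thesis .
  qed
  have "contour_integral (circlepath 0 t) (\<lambda>w. 1 / (w - z)) = 2 * pi * \<i>"
    by (intro contour_integral_unique)
       (use Cauchy_integral_circlepath_simple[of "\<lambda>_. 1" 0 t z] assms in auto)
  moreover have "contour_integral (circlepath 0 s) (\<lambda>w. 1 / (w - z)) = 0"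
  proof (intro contour_integral_unique)
    have "(\<lambda>w. 1 / (w - z)) holomorphic_on cball 0 s"
      by (intro holomorphic_intros) (use assms in auto)
    then show "((\<lambda>w. 1 / (w - z)) has_contour_integral 0) (circlepath 0 s)"
      by (rule Cauchy_theorem_convex_simple) (use assms in auto)
  qed
  ultimately show ?thesis
    using eq split[of s] split[of t] by (simp add: algebra_simps)
qed

section \<open>Finite expansions of the Cauchy kernel and the truncated Laurent sum\<close>

lemma geometric_kernel_outer:
  fixes w z :: "'a::field"
  assumes "w \<noteq> 0" "w \<noteq> z"
  shows "1 / (w - z) = (\<Sum>k\<le>n. z ^ k / w ^ Suc k) + (z / w) ^ Suc n / (w - z)"
proof (induction n)
  case 0
  then show ?case using assms by (simp add: field_simps)
next
  case (Suc n)
  have "(z / w) ^ Suc n / (w - z) = z ^ Suc n / w ^ Suc (Suc n) + (z / w) ^ Suc (Suc n) / (w - z)"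
    using assms by (simp add: divide_simps) (simp add: algebra_simps)
  then show ?case using Suc by (simp add: add.assoc)
qed

text \<open>The outer expansion with \<open>w\<close> and \<open>z\<close> exchanged. It stops one
  term earlier, so that the powers of \<open>1/z\<close> also end at exponent
  \<open>n\<close>.\<close>

lemma geometric_kernel_inner:
  fixes w z :: "'a::field"
  assumes "z \<noteq> 0" "w \<noteq> z"
  shows "1 / (w - z) = (w / z) ^ n / (w - z) - (\<Sum>k<n. w ^ k / z ^ Suc k)"
proof (cases n)
  case (Suc m)
  then show ?thesis
    using geometric_kernel_outer[of z w m] assms
    by (simp add: lessThan_Suc_atMost divide_simps del: sum.lessThan_Suc sum.atMost_Suc)
       (simp add: algebra_simps)
qed simp

lemma norm_contour_integral_circlepath_le:
  assumes "continuous_on (sphere 0 s) g" "0 < s" "0 \<le> B" "\<And>w. norm w = s \<Longrightarrow> norm (g w) \<le> B"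
  shows "norm (contour_integral (circlepath 0 s) g) \<le> B * (2 * pi * s)"
  by (rule has_contour_integral_bound_circlepath[OF has_contour_integral_integral])
     (use assms in \<open>auto intro!: contour_integrable_continuous_circlepath\<close>)

text \<open>Since \<open>f\<close> is controlled only on the open annulus, the estimate is first
  made on the circles of radius \<open>s\<close> and \<open>1/s\<close> with
  \<open>1 < s < r\<close>; then \<open>s\<close> tends to \<open>r\<close>.\<close>

lemma laurent_truncation:
  fixes f :: "complex \<Rightarrow> complex"
  assumes r: "r > 1" and hol: "f holomorphic_on {w. inverse r < norm w \<and> norm w < r}"
    and bound: "\<And>w. inverse r < norm w \<Longrightarrow> norm w < r \<Longrightarrow> norm (f w) \<le> C"
  shows "\<exists>a b. \<forall>z. norm z = 1 \<longrightarrow>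
      norm (f z - ((\<Sum>k\<le>n. a k * z ^ k) + (\<Sum>k<n. b k / z ^ Suc k))) \<le> 2 * C * inverse r ^ n / (r - 1)"
proof -
  let ?I = "\<lambda>s. contour_integral (circlepath 0 s)"
  have C: "C \<ge> 0"
    using bound[of 1] r norm_ge_zero[of "f 1"] by (simp add: inverse_less_1_iff order.trans[OF norm_ge_zero])
  \<comment> \<open>Coefficients taken on the unit circle do not depend on \<open>s\<close>, so the
    truncated sum stays fixed in the later limit.\<close>
  define a where "a = (\<lambda>k. ?I 1 (\<lambda>w. f w / w ^ Suc k) / (2 * pi * \<i>))"
  define b where "b = (\<lambda>k. ?I 1 (\<lambda>w. f w * w ^ k) / (2 * pi * \<i>))"
  have step: "norm (f z - ((\<Sum>k\<le>n. a k * z ^ k) + (\<Sum>k<n. b k / z ^ Suc k)))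
      \<le> 2 * C * inverse s ^ n / (s - 1)" if z: "norm z = 1" and s: "1 < s" "s < r" for z s
  proof -
    define X where "X = (f z - ((\<Sum>k\<le>n. a k * z ^ k) + (\<Sum>k<n. b k / z ^ Suc k)))"
    have ss: "inverse s < 1" "inverse r < inverse s" "inverse r < s" "inverse s < r" "s > 0" "inverse r < 1"
      using s r less_imp_inverse_less[of s r] one_less_inverse_iff[of s] inverse_less_1_iff[of s]
        inverse_less_1_iff[of r] by auto
    have "z \<noteq> 0" using z by auto
    have cont: "continuous_on (sphere 0 q) f" if "q \<in> {s, inverse s}" for q
      by (intro holomorphic_on_imp_continuous_on holomorphic_on_subset[OF hol])
         (use that ss s in auto)
    have ak: "?I s (\<lambda>w. f w / w ^ Suc k) = 2 * pi * \<i> * a k" for k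
    proof -
      have "?I s (\<lambda>w. f w / w ^ Suc k) = ?I 1 (\<lambda>w. f w / w ^ Suc k)"
        by (rule contour_integral_circlepath_annulus[of _ "inverse r" r])
           (use ss s r in \<open>auto intro!: holomorphic_intros hol\<close>)
      then show ?thesis by (simp add: a_def)
    qed
    have bk: "?I (inverse s) (\<lambda>w. f w * w ^ k) = 2 * pi * \<i> * b k" for k
    proof -
      have "?I (inverse s) (\<lambda>w. f w * w ^ k) = ?I 1 (\<lambda>w. f w * w ^ k)"
        by (rule contour_integral_circlepath_annulus[of _ "inverse r" r])
           (use ss s r in \<open>auto intro!: holomorphic_intros hol\<close>)
      then show ?thesis by (simp add: b_def)
    qed
    \<comment> \<open>\<open>E\<close> and \<open>E'\<close> integrate the remainders of the outer
      and inner kernel expansions.\<close>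
    define E where "E = ?I s (\<lambda>w. f w * ((z / w) ^ Suc n / (w - z)))"
    define E' where "E' = ?I (inverse s) (\<lambda>w. f w * ((w / z) ^ n / (w - z)))"
    have ne: "w \<noteq> 0 \<and> w \<noteq> z" if "norm w = s \<or> norm w = inverse s" for w
      using that s ss z by auto
    have outer: "?I s (\<lambda>w. f w / (w - z)) = 2 * pi * \<i> * (\<Sum>k\<le>n. a k * z ^ k) + E"
    proof -
      have "?I s (\<lambda>w. f w / (w - z)) =
          ?I s (\<lambda>w. (\<Sum>k\<le>n. z ^ k * (f w / w ^ Suc k)) + f w * ((z / w) ^ Suc n / (w - z)))"
      proof (rule contour_integral_cong[OF refl])
        fix w assume "w \<in> path_image (circlepath 0 s)"
        then have w: "w \<noteq> 0" "w \<noteq> z" using ne[of w] ss by auto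
        have "f w / (w - z) = f w * (1 / (w - z))" by simp
        also have "\<dots> = f w * ((\<Sum>k\<le>n. z ^ k / w ^ Suc k) + (z / w) ^ Suc n / (w - z))"
          by (subst geometric_kernel_outer[OF w, of n]) (rule refl)
        finally show "f w / (w - z) =
            (\<Sum>k\<le>n. z ^ k * (f w / w ^ Suc k)) + f w * ((z / w) ^ Suc n / (w - z))"
          by (simp add: distrib_left sum_distrib_left mult_ac del: power_Suc)
      qed
      also have "\<dots> = (\<Sum>k\<le>n. ?I s (\<lambda>w. z ^ k * (f w / w ^ Suc k))) + E"
      proof -
        have "(\<lambda>w. z ^ k * (f w / w ^ Suc k)) contour_integrable_on circlepath 0 s" for k
          by (intro contour_integrable_continuous_circlepath continuous_intros)
             (use ne ss cont in \<open>auto simp del: power_Suc\<close>)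
        moreover have "(\<lambda>w. f w * ((z / w) ^ Suc n / (w - z))) contour_integrable_on circlepath 0 s"
          by (intro contour_integrable_continuous_circlepath continuous_intros)
             (use ne ss cont in \<open>auto simp del: power_Suc\<close>)
        ultimately show ?thesis
          unfolding E_def
          by (subst contour_integral_add) (simp_all del: power_Suc add: contour_integrable_sum contour_integral_sum)
      qed
      also have "(\<Sum>k\<le>n. ?I s (\<lambda>w. z ^ k * (f w / w ^ Suc k))) =
          (\<Sum>k\<le>n. z ^ k * (2 * pi * \<i> * a k))"
        unfolding ak[symmetric] using ne ss cont
        by (intro sum.cong refl contour_integral_lmul contour_integrable_continuous_circlepath continuous_intros)
           (auto simp del: power_Suc)
      finally show ?thesis
        by (simp add: sum_distrib_left mult_ac)
    qed
    have inner: "?I (inverse s) (\<lambda>w. f w / (w - z)) = E' - 2 * pi * \<i> * (\<Sum>k<n. b k / z ^ Suc k)"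
    proof -
      have "?I (inverse s) (\<lambda>w. f w / (w - z)) =
          ?I (inverse s) (\<lambda>w. f w * ((w / z) ^ n / (w - z)) - (\<Sum>k<n. 1 / z ^ Suc k * (f w * w ^ k)))"
      proof (rule contour_integral_cong[OF refl])
        fix w assume "w \<in> path_image (circlepath 0 (inverse s))"
        then have w: "z \<noteq> 0" "w \<noteq> z" using ne[of w] ss \<open>z \<noteq> 0\<close> by auto
        have "f w / (w - z) = f w * (1 / (w - z))" by simp
        also have "\<dots> = f w * ((w / z) ^ n / (w - z) - (\<Sum>k<n. w ^ k / z ^ Suc k))"
          by (subst geometric_kernel_inner[OF w, of n]) (rule refl)
        finally show "f w / (w - z) =
            f w * ((w / z) ^ n / (w - z)) - (\<Sum>k<n. 1 / z ^ Suc k * (f w * w ^ k))"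
          by (simp add: right_diff_distrib sum_distrib_left mult_ac del: power_Suc)
      qed
      also have "\<dots> = E' - (\<Sum>k<n. ?I (inverse s) (\<lambda>w. 1 / z ^ Suc k * (f w * w ^ k)))"
      proof -
        have "(\<lambda>w. 1 / z ^ Suc k * (f w * w ^ k)) contour_integrable_on circlepath 0 (inverse s)" for k
          by (intro contour_integrable_continuous_circlepath continuous_intros)
             (use ne ss cont \<open>z \<noteq> 0\<close> in \<open>auto simp del: power_Suc\<close>)
        moreover have "(\<lambda>w. f w * ((w / z) ^ n / (w - z))) contour_integrable_on circlepath 0 (inverse s)"
          by (intro contour_integrable_continuous_circlepath continuous_intros)
             (use ne ss cont \<open>z \<noteq> 0\<close> in \<open>auto simp del: power_Suc\<close>)
        ultimately show ?thesis
          unfolding E'_def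
          by (subst contour_integral_diff) (simp_all del: power_Suc add: contour_integrable_sum contour_integral_sum)
      qed
      also have "(\<Sum>k<n. ?I (inverse s) (\<lambda>w. 1 / z ^ Suc k * (f w * w ^ k))) =
          (\<Sum>k<n. 1 / z ^ Suc k * (2 * pi * \<i> * b k))"
        unfolding bk[symmetric] using ne ss cont \<open>z \<noteq> 0\<close>
        by (intro sum.cong refl contour_integral_lmul contour_integrable_continuous_circlepath continuous_intros)
           (auto simp del: power_Suc)
      finally show ?thesis
        by (simp add: sum_distrib_left mult_ac)
    qed
    have "2 * pi * \<i> * f z = ?I s (\<lambda>w. f w / (w - z)) - ?I (inverse s) (\<lambda>w. f w / (w - z))"
      by (rule Cauchy_integral_formula_annulus[OF hol, symmetric]) (use ss s r z in auto)
    then have "E - E' = 2 * pi * \<i> * X"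
      unfolding outer inner X_def by (simp add: algebra_simps)
    then have "2 * pi * norm X = norm (E - E')"
      by (simp add: norm_mult)
    also have "\<dots> \<le> norm E + norm E'"
      by (rule norm_triangle_ineq4)
    also have "norm E \<le> C * (inverse s ^ Suc n / (s - 1)) * (2 * pi * s)"
      unfolding E_def
    proof (rule norm_contour_integral_circlepath_le)
      fix w :: complex assume w: "norm w = s"
      have "s - 1 \<le> norm (w - z)" using norm_triangle_ineq2[of w z] w z by simp
      then have "inverse s ^ Suc n / norm (w - z) \<le> inverse s ^ Suc n / (s - 1)"
        using s by (intro divide_left_mono mult_pos_pos) auto
      moreover have "norm (f w) \<le> C" using bound w ss s by auto
      ultimately have "norm (f w) * (inverse s ^ Suc n / norm (w - z)) \<le> C * (inverse s ^ Suc n / (s - 1))"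
        using C ss by (intro mult_mono) auto
      then show "norm (f w * ((z / w) ^ Suc n / (w - z))) \<le> C * (inverse s ^ Suc n / (s - 1))"
        by (simp add: norm_mult norm_divide norm_power w z inverse_eq_divide power_one_over del: power_Suc)
    next
      show "continuous_on (sphere 0 s) (\<lambda>w. f w * ((z / w) ^ Suc n / (w - z)))"
        by (intro continuous_intros cont) (use ne ss in \<open>auto simp del: power_Suc\<close>)
    qed (use C ss s in \<open>auto intro!: mult_nonneg_nonneg divide_nonneg_nonneg\<close>)
    also have "norm E' \<le> C * (inverse s ^ n / (1 - inverse s)) * (2 * pi * inverse s)"
      unfolding E'_def
    proof (rule norm_contour_integral_circlepath_le)
      fix w :: complex assume w: "norm w = inverse s"
      have "1 - inverse s \<le> norm (w - z)" using norm_triangle_ineq2[of z w] w z by (simp add: norm_minus_commute)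
      then have "inverse s ^ n / norm (w - z) \<le> inverse s ^ n / (1 - inverse s)"
        using ss by (intro divide_left_mono mult_pos_pos) auto
      moreover have "norm (f w) \<le> C" using bound w ss s by auto
      ultimately have "norm (f w) * (inverse s ^ n / norm (w - z)) \<le> C * (inverse s ^ n / (1 - inverse s))"
        using C ss by (intro mult_mono) auto
      then show "norm (f w * ((w / z) ^ n / (w - z))) \<le> C * (inverse s ^ n / (1 - inverse s))"
        by (simp add: norm_mult norm_divide norm_power w z)
    next
      show "continuous_on (sphere 0 (inverse s)) (\<lambda>w. f w * ((w / z) ^ n / (w - z)))"
        by (intro continuous_intros cont) (use ne ss \<open>z \<noteq> 0\<close> in auto)
    qed (use C ss s in \<open>auto intro!: mult_nonneg_nonneg divide_nonneg_nonneg\<close>)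
    \<comment> \<open>The extra factor \<open>1/s\<close> in the outer remainder cancels the length
      of the large circle; for the inner one, \<open>(1/s) / (1 - 1/s) = 1 / (s - 1)\<close>. Both
      contributions are thus equal.\<close>
    also have "C * (inverse s ^ Suc n / (s - 1)) * (2 * pi * s) +
        C * (inverse s ^ n / (1 - inverse s)) * (2 * pi * inverse s) =
        2 * pi * (2 * C * inverse s ^ n / (s - 1))"
      using s by (simp add: divide_simps)
    finally show ?thesis
      unfolding X_def[symmetric]
      by (simp only: mult_le_cancel_left_pos[OF mult_pos_pos[OF zero_less_numeral pi_gt_zero]])
  qed
  have "norm (f z - ((\<Sum>k\<le>n. a k * z ^ k) + (\<Sum>k<n. b k / z ^ Suc k)))
      \<le> 2 * C * inverse r ^ n / (r - 1)" if z: "norm z = 1" for z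
  proof (rule tendsto_lowerbound)
    show "((\<lambda>s. 2 * C * inverse s ^ n / (s - 1)) \<longlongrightarrow> 2 * C * inverse r ^ n / (r - 1)) (at_left r)"
      by (intro tendsto_intros) (use r in auto)
    have "\<forall>\<^sub>F s in at_left r. 1 < s \<and> s < r"
      using eventually_at_left_real[OF r] by (auto elim!: eventually_mono)
    then show "\<forall>\<^sub>F s in at_left r. norm (f z - ((\<Sum>k\<le>n. a k * z ^ k) + (\<Sum>k<n. b k / z ^ Suc k)))
        \<le> 2 * C * inverse s ^ n / (s - 1)"
      by eventually_elim (use step z in blast)
  qed auto
  then show ?thesis by blast
qed

subsection \<open>Polynomial approximation\<close>

text \<open>The Chebyshev polynomials of the first kind, from the recurrence
  \<open>cos ((k+2) t) = 2 cos t cos ((k+1) t) - cos (k t)\<close>.\<close>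

lemma cos_multiple_poly:
  "\<exists>p :: real poly. degree p \<le> k \<and> (\<forall>t. poly p (cos t) = cos (real k * t))"
proof (induction k rule: induct_nat_012)
  case 0
  show ?case by (rule exI[of _ 1]) simp
next
  case 1
  show ?case by (rule exI[of _ "[:0, 1:]"]) simp
next
  case (ge2 k)
  then obtain p q :: "real poly" where
    p: "degree p \<le> k" "\<And>t. poly p (cos t) = cos (real k * t)" and
    q: "degree q \<le> Suc k" "\<And>t. poly q (cos t) = cos (real (Suc k) * t)"
    by blast
  have "degree ([:0, 2:] * q - p) \<le> Suc (Suc k)"
    using p(1) q(1) by (intro degree_diff_le order.trans[OF degree_mult_le]) auto
  moreover have "poly ([:0, 2:] * q - p) (cos t) = cos (real (Suc (Suc k)) * t)" for t
    using cos_add[of "real (Suc k) * t" t] cos_diff[of "real (Suc k) * t" t]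
    by (simp add: p q algebra_simps)
  ultimately show ?case by blast
qed

lemma bernstein_ellipse_polynomial_approximation:
  fixes G :: "complex \<Rightarrow> complex" and g :: "real \<Rightarrow> real"
  assumes r: "r > 1" and hol: "G holomorphic_on bernstein_ellipse r"
    and bound: "\<And>z. z \<in> bernstein_ellipse r \<Longrightarrow> norm (G z) \<le> C"
    and real: "\<And>x. x \<in> {-1..1} \<Longrightarrow> G (of_real x) = of_real (g x)"
  shows "\<exists>p. degree p \<le> n \<and>
    (\<forall>x\<in>{-1..1}. \<bar>g x - poly p x\<bar> \<le> 2 * C * inverse r ^ n / (r - 1))"
proof -
  define H where "H = (\<lambda>w. G ((w + inverse w) / 2))"
  let ?e = "2 * C * inverse r ^ n / (r - 1)"
  let ?A = "{w :: complex. inverse r < norm w \<and> norm w < r}"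
  have "inverse r > 0" using r by simp
  have "(\<lambda>w. (w + inverse w) / 2) holomorphic_on ?A"
    by (intro holomorphic_intros) (use \<open>inverse r > 0\<close> in auto)
  then have "H holomorphic_on ?A"
    unfolding H_def using joukowski_mem_bernstein_ellipse[OF r]
    by (intro holomorphic_on_compose_gen[OF _ hol, unfolded o_def]) auto
  moreover have "norm (H w) \<le> C" if "inverse r < norm w" "norm w < r" for w
    unfolding H_def by (intro bound joukowski_mem_bernstein_ellipse r that)
  ultimately have "\<exists>a b. \<forall>z. norm z = 1 \<longrightarrow>
      norm (H z - ((\<Sum>k\<le>n. a k * z ^ k) + (\<Sum>k<n. b k / z ^ Suc k))) \<le> ?e"
    by (rule laurent_truncation[OF r])
  then obtain a b where ab: "\<And>z. norm z = 1 \<Longrightarrow>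
      norm (H z - ((\<Sum>k\<le>n. a k * z ^ k) + (\<Sum>k<n. b k / z ^ Suc k))) \<le> ?e"
    by blast
  \<comment> \<open>The powers \<open>z ^ k\<close> and \<open>1 / z ^ k\<close> both contribute to
    \<open>cos (k t)\<close>. The latter has coefficient \<open>b (k - 1)\<close>, and for
    \<open>k = 0\<close> there is none. Real parts suffice because \<open>g\<close> is real.\<close>
  define c where "c = (\<lambda>k. Re (a k) + (if k = 0 then 0 else Re (b (k - 1))))"
  obtain T :: "nat \<Rightarrow> real poly" where
    T: "\<And>k. degree (T k) \<le> k" "\<And>k t. poly (T k) (cos t) = cos (real k * t)"
    using cos_multiple_poly by metis
  define p where "p = (\<Sum>k\<le>n. smult (c k) (T k))"
  have "degree p \<le> n"
    unfolding p_def by (intro degree_sum_le) (auto intro: order.trans[OF degree_smult_le] order.trans[OF T(1)])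
  moreover have "\<bar>g x - poly p x\<bar> \<le> ?e" if x: "x \<in> {-1..1}" for x
  proof -
    define t where "t = arccos x"
    have xt: "x = cos t" using x by (simp add: t_def)
    define S where "S = (\<lambda>z. (\<Sum>k\<le>n. a k * z ^ k) + (\<Sum>k<n. b k / z ^ Suc k))"
    have H: "H (cis t) = of_real (g x)" "H (cis (- t)) = of_real (g x)"
    proof -
      have "(cis t + inverse (cis t)) / 2 = of_real x" "(cis (- t) + inverse (cis (- t))) / 2 = of_real x"
        by (simp_all add: xt complex_eq_iff)
      then show "H (cis t) = of_real (g x)" "H (cis (- t)) = of_real (g x)"
        unfolding H_def using real[OF x] by simp_all
    qed
    \<comment> \<open>The two points are inverse to each other, so in the sum the sines cancel and
      every power yields twice a cosine.\<close>
    have "S (cis t) + S (cis (- t)) = (\<Sum>k\<le>n. a k * (2 * cos (real k * t))) +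
        (\<Sum>k<n. b k * (2 * cos (real (Suc k) * t)))"
    proof -
      have "a k * cis t ^ k + a k * cis (- t) ^ k = a k * (2 * cos (real k * t))" for k
        by (simp add: Complex.DeMoivre complex_eq_iff)
      moreover have "b k / cis t ^ Suc k + b k / cis (- t) ^ Suc k = b k * (2 * cos (real (Suc k) * t))" for k
        unfolding Complex.DeMoivre
        by (simp add: divide_inverse complex_eq_iff del: of_nat_Suc)
      ultimately show ?thesis
        unfolding S_def by (simp add: sum.distrib[symmetric] algebra_simps)
    qed
    then have "Re (S (cis t) + S (cis (- t))) = 2 * ((\<Sum>k\<le>n. Re (a k) * cos (real k * t)) +
        (\<Sum>k<n. Re (b k) * cos (real (Suc k) * t)))"
      by (simp add: sum_distrib_left mult_ac del: of_nat_Suc)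
    also have "(\<Sum>k<n. Re (b k) * cos (real (Suc k) * t)) =
        (\<Sum>k\<le>n. (if k = 0 then 0 else Re (b (k - 1))) * cos (real k * t))"
      by (simp add: sum.atMost_shift del: of_nat_Suc)
    also have "(\<Sum>k\<le>n. Re (a k) * cos (real k * t)) + \<dots> = poly p x"
      by (simp add: p_def poly_sum xt T c_def sum.distrib[symmetric] algebra_simps)
    \<comment> \<open>\<open>H\<close> takes the value \<open>g x\<close> at both points, so the
      error is the real part of the mean of two Laurent errors and obeys the same bound.\<close>
    finally have "2 * (g x - poly p x) = Re ((H (cis t) - S (cis t)) + (H (cis (- t)) - S (cis (- t))))"
      by (simp add: H)
    then have "\<bar>2 * (g x - poly p x)\<bar> \<le> norm ((H (cis t) - S (cis t)) + (H (cis (- t)) - S (cis (- t))))"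
      by (metis abs_Re_le_cmod)
    also have "\<dots> \<le> ?e + ?e"
      using ab[of "cis t"] ab[of "cis (- t)"] unfolding S_def
      by (intro norm_triangle_mono) auto
    finally show ?thesis by (simp add: abs_mult)
  qed
  ultimately show ?thesis by blast
qed

text \<open>Transport along the affine map: \<open>\<psi>\<close> is the inverse of
  \<open>interval_map a b\<close>, and composing the polynomial with the linear \<open>l\<close>,
  the real form of \<open>interval_map a b\<close>, does not raise its degree.\<close>

lemma transformed_bernstein_ellipse_polynomial_approximation:
  fixes F :: "complex \<Rightarrow> complex" and f :: "real \<Rightarrow> real"
  assumes "a < b" and r: "r > 1"
    and hol: "F holomorphic_on transformed_bernstein_ellipse a b r"
    and bound: "\<And>z. z \<in> transformed_bernstein_ellipse a b r \<Longrightarrow> norm (F z) \<le> C"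
    and real: "\<And>x. x \<in> {a..b} \<Longrightarrow> F (of_real x) = of_real (f x)"
  shows "\<exists>p. degree p \<le> n \<and>
    (\<forall>x\<in>{a..b}. \<bar>f x - poly p x\<bar> \<le> 2 * C * inverse r ^ n / (r - 1))"
proof -
  define \<psi> where "\<psi> = (\<lambda>z :: complex. (of_real (b - a) * z + of_real (a + b)) / 2)"
  have "interval_map a b (\<psi> z) = z" for z
    using \<open>a < b\<close> by (simp add: interval_map_def \<psi>_def divide_simps flip: of_real_diff)
  then have \<psi>: "\<psi> z \<in> transformed_bernstein_ellipse a b r" if "z \<in> bernstein_ellipse r" for z
    using that by (simp add: transformed_bernstein_ellipse_def)
  have "\<psi> holomorphic_on bernstein_ellipse r"
    unfolding \<psi>_def by (intro holomorphic_intros) auto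
  then have "(\<lambda>z. F (\<psi> z)) holomorphic_on bernstein_ellipse r"
    by (rule holomorphic_on_compose_gen[OF _ hol, unfolded o_def]) (use \<psi> in auto)
  moreover have "F (\<psi> (of_real x)) = of_real (f (((b - a) * x + (a + b)) / 2))" if x: "x \<in> {-1..1}" for x
  proof -
    have "(b - a) * x \<le> (b - a) * 1" "(b - a) * (- 1) \<le> (b - a) * x"
      using x \<open>a < b\<close> by (intro mult_left_mono; simp)+
    then have "((b - a) * x + (a + b)) / 2 \<in> {a..b}"
      by (auto simp: field_simps)
    moreover have "\<psi> (of_real x) = of_real (((b - a) * x + (a + b)) / 2)"
      by (simp add: \<psi>_def)
    ultimately show ?thesis using real by metis
  qed
  ultimately have "\<exists>p. degree p \<le> n \<and> (\<forall>x\<in>{-1..1}.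
      \<bar>f (((b - a) * x + (a + b)) / 2) - poly p x\<bar> \<le> 2 * C * inverse r ^ n / (r - 1))"
    by (intro bernstein_ellipse_polynomial_approximation[OF r, of "\<lambda>z. F (\<psi> z)"] bound \<psi>)
  then obtain p :: "real poly" where p: "degree p \<le> n"
    "\<And>x. x \<in> {-1..1} \<Longrightarrow> \<bar>f (((b - a) * x + (a + b)) / 2) - poly p x\<bar> \<le> 2 * C * inverse r ^ n / (r - 1)"
    by blast
  define l where "l = [:- (a + b) / (b - a), 2 / (b - a):]"
  show ?thesis
  proof (intro exI conjI ballI)
    have "degree l \<le> 1" by (simp add: l_def)
    then show "degree (pcompose p l) \<le> n"
      using p(1) mult_le_mono[of "degree p" n "degree l" 1] by (simp add: degree_pcompose)
    fix x assume x: "x \<in> {a..b}"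
    have l: "poly l x = (2 * x - (a + b)) / (b - a)"
      by (simp add: l_def diff_divide_distrib add_divide_distrib)
    have "poly l x \<in> {-1..1}"
      unfolding l using x \<open>a < b\<close> by (auto simp: field_simps)
    moreover have "((b - a) * poly l x + (a + b)) / 2 = x"
      unfolding l times_divide_eq_right using \<open>a < b\<close> by (subst nonzero_mult_div_cancel_left) auto
    ultimately show "\<bar>f x - poly (pcompose p l) x\<bar> \<le> 2 * C * inverse r ^ n / (r - 1)"
      using p(2)[of "poly l x"] by (simp add: poly_pcompose)
  qed
qed

section \<open>Assembly on the cube\<close>

text \<open>The side length is chosen so that the \<open>d\<close> squared coordinate differences,
  each at most \<open>D^2 / d\<close>, add up to at most \<open>D^2\<close>; the argument of
  \<open>f\<close> then stays in its interval.\<close>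

lemma norm_diff_power2_le_cube:
  fixes x y :: "real ^ 'd"
  assumes "D \<ge> 0" "\<And>j. x $ j \<in> {0..D / sqrt (real CARD('d))}" "\<And>j. y $ j \<in> {0..D / sqrt (real CARD('d))}"
  shows "(norm (x - y))\<^sup>2 \<le> D\<^sup>2"
proof -
  have "(norm (x - y))\<^sup>2 = (\<Sum>j\<in>UNIV. (x $ j - y $ j)\<^sup>2)"
    unfolding power2_norm_eq_inner inner_vec_def by (simp add: power2_eq_square)
  also have "\<dots> \<le> (\<Sum>j\<in>(UNIV :: 'd set). (D / sqrt (real CARD('d)))\<^sup>2)"
  proof (rule sum_mono)
    fix j
    have "\<bar>x $ j - y $ j\<bar> \<le> \<bar>D / sqrt (real CARD('d))\<bar>"
      using assms(2,3)[of j] by (auto simp: abs_if)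
    then show "(x $ j - y $ j)\<^sup>2 \<le> (D / sqrt (real CARD('d)))\<^sup>2"
      by (simp only: abs_le_square_iff)
  qed
  also have "\<dots> = D\<^sup>2"
    by (simp add: power_divide)
  finally show ?thesis .
qed

theorem theorem2p1:
  fixes f :: "real \<Rightarrow> real" and F :: "complex \<Rightarrow> complex"
    and K :: "real ^ 'd \<Rightarrow> real ^ 'd \<Rightarrow> real"
    and D \<rho> C :: real and Q :: "(real ^ 'd) set"
  assumes "D > 0" and "\<rho>\<^sup>2 > 1"
    and "real_analytic_on f {0..D\<^sup>2}"
    and "F analytic_on transformed_bernstein_ellipse 0 (D\<^sup>2) (\<rho>\<^sup>2)"
    and "\<And>t. t \<in> {0..D\<^sup>2} \<Longrightarrow> F (of_real t) = of_real (f t)"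
    and "\<And>z. z \<in> transformed_bernstein_ellipse 0 (D\<^sup>2) (\<rho>\<^sup>2) \<Longrightarrow> norm (F z) \<le> C"
    and "Q = {x. \<forall>j. x $ j \<in> {0..D / sqrt (real CARD('d))}}"
    and "\<And>x y. x \<in> Q \<Longrightarrow> y \<in> Q \<Longrightarrow> K x y = f ((norm (x - y))\<^sup>2)"
  shows "\<forall>n :: nat. \<forall>R. R = (n + CARD('d) + 2) choose (CARD('d) + 2) \<longrightarrow>
           (\<exists>g h :: nat \<Rightarrow> real ^ 'd \<Rightarrow> real.
              (\<forall>i\<in>{1..R}. real_polynomial_function (g i) \<and> real_polynomial_function (h i)) \<and>
              (\<forall>x\<in>Q. \<forall>y\<in>Q. \<bar>K x y - (\<Sum>i=1..R. g i x * h i y)\<bar>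
                 \<le> 2 * C * \<rho> powi (- 2 * int n) / (\<rho>\<^sup>2 - 1)))"
proof (intro allI impI)
  fix n R :: nat
  assume R: "R = (n + CARD('d) + 2) choose (CARD('d) + 2)"
  have "0 < D\<^sup>2" using \<open>D > 0\<close> by simp
  then have "\<exists>p. degree p \<le> n \<and>
      (\<forall>t\<in>{0..D\<^sup>2}. \<bar>f t - poly p t\<bar> \<le> 2 * C * inverse (\<rho>\<^sup>2) ^ n / (\<rho>\<^sup>2 - 1))"
    by (rule transformed_bernstein_ellipse_polynomial_approximation[OF _ assms(2)
          analytic_imp_holomorphic[OF assms(4)] assms(6) assms(5)])
  then obtain p where p: "degree p \<le> n"
      "\<And>t. t \<in> {0..D\<^sup>2} \<Longrightarrow> \<bar>f t - poly p t\<bar> \<le> 2 * C * inverse (\<rho>\<^sup>2) ^ n / (\<rho>\<^sup>2 - 1)"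
    by blast
  \<comment> \<open>The degree may be below \<open>n\<close>; the padding coefficients are 0, and
    the term count can depend on \<open>n\<close> alone.\<close>
  have poly: "(\<Sum>k\<le>n. coeff p k * t ^ k) = poly p t" for t
    unfolding poly_altdef using p(1)
    by (intro sum.mono_neutral_right) (auto simp: coeff_eq_0)
  obtain g h :: "nat \<Rightarrow> real ^ 'd \<Rightarrow> real" where
    gh: "\<And>i. i < R \<Longrightarrow> real_polynomial_function (g i) \<and> real_polynomial_function (h i)"
      "\<And>x y. poly p ((norm (x - y))\<^sup>2) = (\<Sum>i<R. g i x * h i y)"
    using separable_rank_le_polynomial_norm_diff[where 'd = 'd, of n "coeff p"]
    unfolding separable_rank_le_def poly R by blast
  \<comment> \<open>The exponent is even, so the sign of \<open>\<rho>\<close> does not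
    matter.\<close>
  have powi: "\<rho> powi (- 2 * int n) = inverse (\<rho>\<^sup>2) ^ n"
    by (simp add: power_int_def power_mult power_inverse nat_mult_distrib)
  show "\<exists>g h :: nat \<Rightarrow> real ^ 'd \<Rightarrow> real.
        (\<forall>i\<in>{1..R}. real_polynomial_function (g i) \<and> real_polynomial_function (h i)) \<and>
        (\<forall>x\<in>Q. \<forall>y\<in>Q. \<bar>K x y - (\<Sum>i=1..R. g i x * h i y)\<bar>
           \<le> 2 * C * \<rho> powi (- 2 * int n) / (\<rho>\<^sup>2 - 1))"
  \<comment> \<open>The witnesses are \<open>g\<close> and \<open>h\<close> shifted by one, from
    indices below \<open>R\<close> to \<open>1..R\<close>.\<close>
  proof (intro exI conjI ballI)
    fix i assume "i \<in> {1..R}"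
    then show "real_polynomial_function (g (i - 1))" "real_polynomial_function (h (i - 1))"
      using gh(1)[of "i - 1"] by auto
  next
    fix x y assume xy: "x \<in> Q" "y \<in> Q"
    have "(\<Sum>i=1..R. g (i - 1) x * h (i - 1) y) = (\<Sum>i<R. g i x * h i y)"
      by (simp add: sum.atLeast1_atMost_eq)
    moreover have "(norm (x - y))\<^sup>2 \<in> {0..D\<^sup>2}"
      using norm_diff_power2_le_cube[of D x y] xy assms(1,7) by auto
    ultimately show "\<bar>K x y - (\<Sum>i=1..R. g (i - 1) x * h (i - 1) y)\<bar>
        \<le> 2 * C * \<rho> powi (- 2 * int n) / (\<rho>\<^sup>2 - 1)"
      using p(2)[of "(norm (x - y))\<^sup>2"] assms(8)[OF xy] by (simp only: powi gh(2))
  qed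
qed

end
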